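(* Let $S=(S_0,S_T)$ be a traded asset and $\alpha\in(0,1)$. (i) The following statements are equivalent: (a) $\rho_{\mathscr{A}_\alpha,S}(X)<\infty$ for every $X\in\mathscr{X}$; (b) $\mathrm{VaR}_\alpha(S_T)<0$; (c) $\mathbb{P}[S_T<\lambda]\le\alpha$ for some $\lambda>0$. In the case that $\Omega$ is finite, these statements are equivalent to $\mathbb{P}[S_T=0]\le\alpha$. (ii) The following statements are equivalent: (a) $\rho_{\mathscr{A}_\alpha,S}(X)>-\infty$ for every $X\in\mathscr{X}$; (b) $\mathrm{VaR}_\alpha(-S_T)>0$; (c) $\mathbb{P}[S_T>0]>\alpha$ (equivalently, $\mathbb{P}[S_T=0]<1-\alpha$).
   Context: Let $(\Omega,\mathcal{F},\mathbb{P})$ be a probability space and $\mathscr{X}$ the Banach space of bounded $\mathcal{F}$-measurable functions $X:\Omega\to\mathbb{R}$ with the supremum norm and the pointwise order (functions are not identified almost surely); $\mathscr{X}_+=\{X\in\mathscr{X}: X\ge 0\}$. For $\alpha\in(0,1)$ and $X\in\mathscr{X}$, $\mathrm{VaR}_\alpha(X)=\inf\{m\in\mathbb{R}:\mathbb{P}[X+m<0]\le\alpha\}$, and $\mathscr{A}_\alpha=\{X\in\mathscr{X}:\mathrm{VaR}_\alpha(X)\le 0\}=\{X\in\mathscr{X}:\mathbb{P}[X<0]\le\alpha\}$. A traded asset is a pair $S=(S_0,S_T)$ with $S_0\in\mathbb{R}$, $S_0>0$, and $S_T\in\mathscr{X}_+$, $S_T\ne 0$. For $\mathscr{A}\subset\mathscr{X}$,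 $\rho_{\mathscr{A},S}:\mathscr{X}\to\mathbb{R}\cup\{-\infty,\infty\}$ is $\rho_{\mathscr{A},S}(X)=\inf\{m\in\mathbb{R}: X+\frac{m}{S_0}S_T\in\mathscr{A}\}$ (with $\inf\emptyset=\infty$). *)

theory Defs
  imports "HOL-Probability.Probability"
begin

text \<open>
  The state space is \<open>space M\<close>. Functions are not identified almost surely; values outside
  \<open>space M\<close> play no role, so pointwise conditions are all relative to \<open>space M\<close>.
\<close>

definition bounded_rvs :: "'a measure \<Rightarrow> ('a \<Rightarrow> real) set" where
  "bounded_rvs M = {X \<in> borel_measurable M. bounded (X ` space M)}"

definition nonneg_bounded_rvs :: "'a measure \<Rightarrow> ('a \<Rightarrow> real) set" where
  "nonneg_bounded_rvs M = {X \<in> bounded_rvs M. \<forall>\<omega>\<in>space M. 0 \<le> X \<omega>}"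

text \<open>
  The infimum is taken in the extended reals, so it needs no side condition; for
  \<open>0 < \<alpha> < 1\<close> and bounded \<open>X\<close> it is finite (\<open>VaR_finite\<close> below).
\<close>

definition VaR :: "'a measure \<Rightarrow> real \<Rightarrow> ('a \<Rightarrow> real) \<Rightarrow> ereal" where
  "VaR M \<alpha> X = Inf {ereal m | m. \<P>(\<omega> in M. X \<omega> + m < 0) \<le> \<alpha>}"

definition VaR_acceptance :: "'a measure \<Rightarrow> real \<Rightarrow> ('a \<Rightarrow> real) set" where
  "VaR_acceptance M \<alpha> = {X \<in> bounded_rvs M. VaR M \<alpha> X \<le> 0}"

text \<open>
  An asset is a pair of a price and a payoff. The payoff is nonzero as a function, i.e. at some
  state; it may still vanish almost surely.
\<close>

definition traded_asset :: "'a measure \<Rightarrow> real \<times> ('a \<Rightarrow> real) \<Rightarrow> bool" where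
  "traded_asset M S \<longleftrightarrow>
     0 < fst S \<and> snd S \<in> nonneg_bounded_rvs M \<and> (\<exists>\<omega>\<in>space M. snd S \<omega> \<noteq> 0)"

definition risk_measure ::
  "('a \<Rightarrow> real) set \<Rightarrow> real \<times> ('a \<Rightarrow> real) \<Rightarrow> ('a \<Rightarrow> real) \<Rightarrow> ereal" where
  "risk_measure A S X = Inf {ereal m | m. (\<lambda>\<omega>. X \<omega> + m / fst S * snd S \<omega>) \<in> A}"

lemma VaR_finite:
  assumes "prob_space M" and "0 < \<alpha>" and "\<alpha> < 1" and "X \<in> bounded_rvs M"
  shows "\<bar>VaR M \<alpha> X\<bar> \<noteq> \<infinity>"
proof -
  interpret prob_space M by fact
  obtain B where B: "\<And>\<omega>. \<omega> \<in> space M \<Longrightarrow> \<bar>X \<omega>\<bar> \<le> B"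
    using assms(4) by (auto simp: bounded_rvs_def bounded_iff)
  have "{\<omega> \<in> space M. X \<omega> + B < 0} = {}"
    using B by fastforce
  then have "\<P>(\<omega> in M. X \<omega> + B < 0) \<le> \<alpha>"
    using assms(2) by (simp only: measure_empty less_imp_le)
  then have upper: "VaR M \<alpha> X \<le> ereal B"
    unfolding VaR_def by (intro Inf_lower) auto
  have "ereal (- B) \<le> VaR M \<alpha> X"
    unfolding VaR_def
  proof (rule Inf_greatest)
    fix z assume "z \<in> {ereal m | m. \<P>(\<omega> in M. X \<omega> + m < 0) \<le> \<alpha>}"
    then obtain m where z: "z = ereal m" and m: "\<P>(\<omega> in M. X \<omega> + m < 0) \<le> \<alpha>"
      by blast
    have "\<not> m < - B"
    proof
      assume "m < - B"
      then have "{\<omega> \<in> space M. X \<omega> + m < 0} = space M"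
        using B by fastforce
      then show False
        using m assms(3) prob_space by simp
    qed
    then show "ereal (- B) \<le> z"
      by (simp add: z)
  qed
  with upper show ?thesis
    by (cases "VaR M \<alpha> X") auto
qed

lemma VaR_acceptance_eq:
  assumes "prob_space M"
  shows "VaR_acceptance M \<alpha> = {X \<in> bounded_rvs M. \<P>(\<omega> in M. X \<omega> < 0) \<le> \<alpha>}"
proof -
  interpret prob_space M by fact
  have "\<P>(\<omega> in M. X \<omega> < 0) \<le> \<alpha>" if X: "X \<in> bounded_rvs M" and le: "VaR M \<alpha> X \<le> 0" for X
  proof -
    have [measurable]: "X \<in> borel_measurable M"
      using X by (simp add: bounded_rvs_def)
    define A where "A n = {\<omega> \<in> space M. X \<omega> + inverse (real (Suc n)) < 0}" for n
    have bound: "prob (A n) \<le> \<alpha>" for n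
    proof -
      have "VaR M \<alpha> X < ereal (inverse (real (Suc n)))"
        using le by (rule le_less_trans) simp
      then obtain m where m: "m < inverse (real (Suc n))"
        and p: "\<P>(\<omega> in M. X \<omega> + m < 0) \<le> \<alpha>"
        unfolding VaR_def Inf_less_iff by auto
      have "prob (A n) \<le> \<P>(\<omega> in M. X \<omega> + m < 0)"
        unfolding A_def using m by (intro finite_measure_mono) auto
      with p show ?thesis by simp
    qed
    have inc: "incseq A"
    proof (rule incseq_SucI)
      fix n
      have "inverse (real (Suc (Suc n))) \<le> inverse (real (Suc n))"
        by (rule le_imp_inverse_le) simp_all
      then show "A n \<subseteq> A (Suc n)"
        unfolding A_def by (blast intro: order_le_less_trans add_left_mono)
    qed
    have un: "(\<Union>n. A n) = {\<omega> \<in> space M. X \<omega> < 0}"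
    proof (intro equalityI subsetI)
      fix \<omega> assume w: "\<omega> \<in> {\<omega> \<in> space M. X \<omega> < 0}"
      then obtain n where "inverse (real (Suc n)) < - X \<omega>"
        using reals_Archimedean[of "- X \<omega>"] by auto
      with w show "\<omega> \<in> (\<Union>n. A n)"
        unfolding A_def by (auto intro!: exI[of _ n])
    next
      fix \<omega> assume "\<omega> \<in> (\<Union>n. A n)"
      then obtain n where "\<omega> \<in> space M" "X \<omega> + inverse (real (Suc n)) < 0"
        unfolding A_def by auto
      moreover have "0 < inverse (real (Suc n))" by simp
      ultimately show "\<omega> \<in> {\<omega> \<in> space M. X \<omega> < 0}"
        by (simp del: inverse_positive_iff_positive)
    qed
    have "range A \<subseteq> sets M"
      unfolding A_def by auto
    then have "(\<lambda>n. prob (A n)) \<longlonglongrightarrow> \<P>(\<omega> in M. X \<omega> < 0)"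
      using finite_Lim_measure_incseq[OF _ inc] un by simp
    then show ?thesis
      by (rule LIMSEQ_le_const2) (use bound in auto)
  qed
  moreover have "VaR M \<alpha> X \<le> 0" if "\<P>(\<omega> in M. X \<omega> < 0) \<le> \<alpha>" for X
    unfolding VaR_def using that by (intro Inf_lower) (auto intro!: exI[of _ "0::real"] simp: zero_ereal_def)
  ultimately show ?thesis
    unfolding VaR_acceptance_def by blast
qed

end

theory Submission imports Defs begin

text \<open>
  The position \<open>- 1\<close> detects finiteness from above: only a positive amount \<open>m\<close> of capital can make
  it acceptable, and then \<open>- 1 + m / S\<^sub>0 * S\<^sub>T < 0\<close> is the event \<open>S\<^sub>T < S\<^sub>0 / m\<close>. The position \<open>0\<close>
  detects finiteness from below: if \<open>- S\<^sub>T\<close> is acceptable, arbitrarily much capital can be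
  withdrawn from \<open>0\<close>. Conversely, if \<open>VaR (- S\<^sub>T) > 0\<close>, then \<open>S\<^sub>T\<close> exceeds some level \<open>e > 0\<close> with
  probability above \<open>\<alpha>\<close>, so large withdrawals make every bounded position negative there.
\<close>

text \<open>Acceptance includes membership in \<open>bounded_rvs M\<close>, so this is needed for
  every position \<open>X\<close> supplemented by a multiple of the payoff, and, with
  \<open>c = - 1\<close>, for the negated payoff.\<close>

lemma bounded_rvs_add_scaled:
  assumes "X \<in> bounded_rvs M" and "Y \<in> bounded_rvs M"
  shows "(\<lambda>\<omega>. X \<omega> + c * Y \<omega>) \<in> bounded_rvs M"
proof -
  have "(\<lambda>\<omega>. X \<omega> + c * Y \<omega>) \<in> borel_measurable M"
    using assms by (auto simp: bounded_rvs_def)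
  moreover have "bounded ((\<lambda>\<omega>. X \<omega> + c * Y \<omega>) ` space M)"
  proof -
    obtain a where a: "\<And>\<omega>. \<omega> \<in> space M \<Longrightarrow> \<bar>X \<omega>\<bar> \<le> a"
      using assms(1) by (auto simp: bounded_rvs_def bounded_iff)
    obtain b where b: "\<And>\<omega>. \<omega> \<in> space M \<Longrightarrow> \<bar>Y \<omega>\<bar> \<le> b"
      using assms(2) by (auto simp: bounded_rvs_def bounded_iff)
    have "\<bar>X \<omega> + c * Y \<omega>\<bar> \<le> a + \<bar>c\<bar> * b" if "\<omega> \<in> space M" for \<omega>
    proof -
      have "\<bar>X \<omega> + c * Y \<omega>\<bar> \<le> \<bar>X \<omega>\<bar> + \<bar>c\<bar> * \<bar>Y \<omega>\<bar>"
        by (metis abs_mult abs_triangle_ineq)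
      also have "\<dots> \<le> a + \<bar>c\<bar> * b"
        using a[OF that] b[OF that] by (intro add_mono mult_left_mono) auto
      finally show ?thesis .
    qed
    then show ?thesis
      by (auto simp: bounded_iff)
  qed
  ultimately show ?thesis
    by (simp add: bounded_rvs_def)
qed

lemma const_in_bounded_rvs: "(\<lambda>_. c) \<in> bounded_rvs M"
  by (simp add: bounded_rvs_def image_constant_conv)

text \<open>An infimum is below 0 exactly when some member of the set is, and a negative admissible
  \<open>m\<close> is the same thing as a level \<open>l = - m\<close>.\<close>

lemma VaR_neg_iff: "VaR M \<alpha> X < 0 \<longleftrightarrow> (\<exists>l>0. \<P>(\<omega> in M. X \<omega> < l) \<le> \<alpha>)"
proof
  assume "VaR M \<alpha> X < 0"
  then obtain m where "m < 0" and "\<P>(\<omega> in M. X \<omega> + m < 0) \<le> \<alpha>"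
    unfolding VaR_def Inf_less_iff by auto
  moreover have "X \<omega> + m < 0 \<longleftrightarrow> X \<omega> < - m" for \<omega>
    by linarith
  ultimately show "\<exists>l>0. \<P>(\<omega> in M. X \<omega> < l) \<le> \<alpha>"
    by (auto intro!: exI[of _ "- m"])
next
  assume "\<exists>l>0. \<P>(\<omega> in M. X \<omega> < l) \<le> \<alpha>"
  then obtain l where "l > 0" and "\<P>(\<omega> in M. X \<omega> < l) \<le> \<alpha>"
    by blast
  then have "VaR M \<alpha> X \<le> ereal (- l)"
    unfolding VaR_def by (intro Inf_lower) (auto intro!: exI[of _ "- l"])
  also have "\<dots> < 0"
    using \<open>l > 0\<close> by simp
  finally show "VaR M \<alpha> X < 0" .
qed

text \<open>This negates \<open>VaR_acceptance_eq\<close>. The substance lies there: continuity from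
  below carries the bound from all positive shifts of \<open>X\<close> to \<open>X\<close>
  itself.\<close>

lemma VaR_pos_iff:
  assumes "prob_space M" and "X \<in> bounded_rvs M"
  shows "VaR M \<alpha> X > 0 \<longleftrightarrow> \<P>(\<omega> in M. X \<omega> < 0) > \<alpha>"
  using VaR_acceptance_eq[OF assms(1), of \<alpha>] assms(2)
  unfolding VaR_acceptance_def by (auto simp flip: not_le)

text \<open>A real \<open>e\<close> strictly between 0 and the infimum is not admissible, so its
  loss probability exceeds \<alpha>. The gain is a threshold bounded away from 0, which a uniform
  estimate for bounded positions requires.\<close>

lemma VaR_pos_obtains_level:
  assumes "VaR M \<alpha> (\<lambda>\<omega>. - X \<omega>) > 0"
  obtains e where "e > 0" and "\<P>(\<omega> in M. X \<omega> > e) > \<alpha>"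
proof -
  obtain e where e: "0 < e" "ereal e < VaR M \<alpha> (\<lambda>\<omega>. - X \<omega>)"
    using ereal_dense2[OF assms] by auto
  have "\<not> \<P>(\<omega> in M. - X \<omega> + e < 0) \<le> \<alpha>"
  proof
    assume "\<P>(\<omega> in M. - X \<omega> + e < 0) \<le> \<alpha>"
    then have "VaR M \<alpha> (\<lambda>\<omega>. - X \<omega>) \<le> ereal e"
      unfolding VaR_def by (intro Inf_lower) auto
    with e(2) show False by simp
  qed
  moreover have "- X \<omega> + e < 0 \<longleftrightarrow> X \<omega> > e" for \<omega>
    by linarith
  ultimately show thesis
    using that[OF e(1)] by simp
qed

text \<open>On a finite space \<open>X\<close> takes finitely many values, so there is a gap between
  0 and its positive values. For \<open>l\<close> within this gap, \<open>X < l\<close> and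
  \<open>X = 0\<close> are the same event.\<close>

lemma prob_eq_0_iff_level:
  assumes "prob_space M" and X: "X \<in> nonneg_bounded_rvs M" and "finite (space M)"
  shows "(\<exists>l>0. \<P>(\<omega> in M. X \<omega> < l) \<le> \<alpha>) \<longleftrightarrow> \<P>(\<omega> in M. X \<omega> = 0) \<le> \<alpha>"
proof
  interpret prob_space M by fact
  have [measurable]: "X \<in> borel_measurable M"
    using X by (simp add: nonneg_bounded_rvs_def bounded_rvs_def)
  assume "\<exists>l>0. \<P>(\<omega> in M. X \<omega> < l) \<le> \<alpha>"
  then obtain l where l: "l > 0" and p: "\<P>(\<omega> in M. X \<omega> < l) \<le> \<alpha>"
    by blast
  have "\<P>(\<omega> in M. X \<omega> = 0) \<le> \<P>(\<omega> in M. X \<omega> < l)"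
    using l by (intro finite_measure_mono) auto
  with p show "\<P>(\<omega> in M. X \<omega> = 0) \<le> \<alpha>" by simp
next
  assume p: "\<P>(\<omega> in M. X \<omega> = 0) \<le> \<alpha>"
  \<comment> \<open>Inserting 1 keeps the set nonempty, so that \<open>Min\<close> is meaningful
    even if \<open>X\<close> vanishes everywhere.\<close>
  define l where "l = Min (insert 1 {x \<in> X ` space M. x > 0})"
  have fin: "finite (insert 1 {x \<in> X ` space M. x > 0})"
    using assms(3) by simp
  have l: "l > 0"
    unfolding l_def using fin by (subst Min_gr_iff) auto
  have "X \<omega> < l \<longleftrightarrow> X \<omega> = 0" if "\<omega> \<in> space M" for \<omega>
  proof (cases "X \<omega> = 0")
    case False
    then have "X \<omega> > 0"
      using X that by (force simp: nonneg_bounded_rvs_def)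
    then have "l \<le> X \<omega>"
      unfolding l_def using fin that by (intro Min_le) auto
    with False show ?thesis by simp
  qed (use l in simp)
  then have "{\<omega> \<in> space M. X \<omega> < l} = {\<omega> \<in> space M. X \<omega> = 0}"
    by blast
  with l p show "\<exists>l>0. \<P>(\<omega> in M. X \<omega> < l) \<le> \<alpha>"
    by auto
qed

lemma prob_pos_iff_prob_eq_0:
  assumes "prob_space M" and X: "X \<in> nonneg_bounded_rvs M"
  shows "\<P>(\<omega> in M. X \<omega> > 0) > \<alpha> \<longleftrightarrow> \<P>(\<omega> in M. X \<omega> = 0) < 1 - \<alpha>"
proof -
  interpret prob_space M by fact
  have [measurable]: "X \<in> borel_measurable M"
    using X by (simp add: nonneg_bounded_rvs_def bounded_rvs_def)
  have "{\<omega> \<in> space M. X \<omega> > 0} = space M - {\<omega> \<in> space M. X \<omega> = 0}"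
    using X by (force simp: nonneg_bounded_rvs_def)
  moreover have "prob (space M - {\<omega> \<in> space M. X \<omega> = 0}) = 1 - \<P>(\<omega> in M. X \<omega> = 0)"
    by (rule prob_compl) measurable
  ultimately show ?thesis
    by auto
qed

text \<open>Capital acts only through the payoff, and a fixed amount covers a uniform loss only
  where the payoff stays above a positive level. This is why the criterion concerns
  \<open>snd S < l\<close> for some \<open>l > 0\<close>.\<close>

lemma risk_measure_less_top_iff:
  assumes "prob_space M" and "traded_asset M S" and "\<alpha> < 1"
  shows "(\<forall>X\<in>bounded_rvs M. risk_measure (VaR_acceptance M \<alpha>) S X < \<infinity>)
    \<longleftrightarrow> (\<exists>l>0. \<P>(\<omega> in M. snd S \<omega> < l) \<le> \<alpha>)"
proof
  interpret prob_space M by fact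
  have S: "0 < fst S" "snd S \<in> bounded_rvs M" "\<And>\<omega>. \<omega> \<in> space M \<Longrightarrow> 0 \<le> snd S \<omega>"
    using assms(2) by (auto simp: traded_asset_def nonneg_bounded_rvs_def)
  assume "\<forall>X\<in>bounded_rvs M. risk_measure (VaR_acceptance M \<alpha>) S X < \<infinity>"
  then have "risk_measure (VaR_acceptance M \<alpha>) S (\<lambda>_. - 1) < \<infinity>"
    using const_in_bounded_rvs by blast
  then obtain m where p: "\<P>(\<omega> in M. - 1 + m / fst S * snd S \<omega> < 0) \<le> \<alpha>"
    unfolding risk_measure_def Inf_less_iff VaR_acceptance_eq[OF assms(1)] by auto
  \<comment> \<open>Otherwise the supplemented position is at most \<open>- 1\<close> everywhere, so
    its loss probability is 1, which exceeds \<alpha>.\<close>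
  have m: "m > 0"
  proof (rule ccontr)
    assume "\<not> m > 0"
    then have "m / fst S * snd S \<omega> \<le> 0" if "\<omega> \<in> space M" for \<omega>
      using S(1) S(3)[OF that] by (intro mult_nonpos_nonneg) (auto simp: divide_le_0_iff)
    then have "{\<omega> \<in> space M. - 1 + m / fst S * snd S \<omega> < 0} = space M"
      by force
    with p assms(3) show False
      using prob_space by simp
  qed
  have "- 1 + m / fst S * snd S \<omega> < 0 \<longleftrightarrow> snd S \<omega> < fst S / m" for \<omega>
    using m S(1) by (simp add: field_simps)
  with p m S(1) show "\<exists>l>0. \<P>(\<omega> in M. snd S \<omega> < l) \<le> \<alpha>"
    by (auto intro!: exI[of _ "fst S / m"])
next
  interpret prob_space M by fact
  have S: "0 < fst S" "snd S \<in> bounded_rvs M"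
    using assms(2) by (auto simp: traded_asset_def nonneg_bounded_rvs_def)
  have [measurable]: "snd S \<in> borel_measurable M"
    using S(2) by (simp add: bounded_rvs_def)
  assume "\<exists>l>0. \<P>(\<omega> in M. snd S \<omega> < l) \<le> \<alpha>"
  then obtain l where l: "l > 0" and p: "\<P>(\<omega> in M. snd S \<omega> < l) \<le> \<alpha>"
    by blast
  show "\<forall>X\<in>bounded_rvs M. risk_measure (VaR_acceptance M \<alpha>) S X < \<infinity>"
  proof
    fix X assume X: "X \<in> bounded_rvs M"
    obtain b where b: "b > 0" "\<And>\<omega>. \<omega> \<in> space M \<Longrightarrow> \<bar>X \<omega>\<bar> \<le> b"
      using X by (auto simp: bounded_rvs_def bounded_pos)
    \<comment> \<open>With this amount, \<open>m / fst S = b / l\<close>: wherever the payoff is at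
      least \<open>l\<close> it contributes at least \<open>b\<close>, the worst loss of
      \<open>X\<close>.\<close>
    define m where "m = fst S * b / l"
    have "{\<omega> \<in> space M. X \<omega> + m / fst S * snd S \<omega> < 0} \<subseteq> {\<omega> \<in> space M. snd S \<omega> < l}"
    proof clarify
      fix \<omega> assume w: "\<omega> \<in> space M" "X \<omega> + m / fst S * snd S \<omega> < 0"
      have "b / l * snd S \<omega> < b"
        using w b(2)[OF w(1)] S(1) by (simp add: m_def)
      then show "snd S \<omega> < l"
        using b(1) l by (simp add: field_simps)
    qed
    then have "\<P>(\<omega> in M. X \<omega> + m / fst S * snd S \<omega> < 0) \<le> \<P>(\<omega> in M. snd S \<omega> < l)"
      by (intro finite_measure_mono) auto
    with p have "(\<lambda>\<omega>. X \<omega> + m / fst S * snd S \<omega>) \<in> VaR_acceptance M \<alpha>"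
      using bounded_rvs_add_scaled[OF X S(2), of "m / fst S"] by (simp add: VaR_acceptance_eq[OF assms(1)])
    then have "risk_measure (VaR_acceptance M \<alpha>) S X \<le> ereal m"
      unfolding risk_measure_def by (intro Inf_lower) auto
    then show "risk_measure (VaR_acceptance M \<alpha>) S X < \<infinity>"
      by (rule le_less_trans) simp
  qed
qed

text \<open>Withdrawing capital hurts only where the payoff is positive. If that event has
  probability at most \<alpha>, withdrawal from 0 is never penalised; if not, a level
  \<open>e\<close> bounds the possible withdrawals for each \<open>X\<close>.\<close>

lemma risk_measure_greater_bot_iff:
  assumes "prob_space M" and "traded_asset M S"
  shows "(\<forall>X\<in>bounded_rvs M. risk_measure (VaR_acceptance M \<alpha>) S X > -\<infinity>)
    \<longleftrightarrow> VaR M \<alpha> (\<lambda>\<omega>. - snd S \<omega>) > 0"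
proof
  interpret prob_space M by fact
  have S: "0 < fst S" "snd S \<in> bounded_rvs M" "\<And>\<omega>. \<omega> \<in> space M \<Longrightarrow> 0 \<le> snd S \<omega>"
    using assms(2) by (auto simp: traded_asset_def nonneg_bounded_rvs_def)
  have [measurable]: "snd S \<in> borel_measurable M"
    using S(2) by (simp add: bounded_rvs_def)
  have neg: "(\<lambda>\<omega>. - snd S \<omega>) \<in> bounded_rvs M"
    using bounded_rvs_add_scaled[OF const_in_bounded_rvs[of 0] S(2), of "- 1"] by simp
  assume gt: "\<forall>X\<in>bounded_rvs M. risk_measure (VaR_acceptance M \<alpha>) S X > -\<infinity>"
  show "VaR M \<alpha> (\<lambda>\<omega>. - snd S \<omega>) > 0"
  proof (rule ccontr)
    assume "\<not> VaR M \<alpha> (\<lambda>\<omega>. - snd S \<omega>) > 0"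
    then have p: "\<P>(\<omega> in M. - snd S \<omega> < 0) \<le> \<alpha>"
      using VaR_pos_iff[OF assms(1) neg] by simp
    have le: "risk_measure (VaR_acceptance M \<alpha>) S (\<lambda>_. 0) \<le> ereal m" for m
    proof -
      \<comment> \<open>The bound holds for \<open>m\<close> of either sign: a negative product
        forces \<open>snd S\<close> to be nonzero, hence positive. The summand \<open>0 +\<close>
        matches the instance of \<open>risk_measure\<close> at the zero position.\<close>
      have "\<P>(\<omega> in M. 0 + m / fst S * snd S \<omega> < 0) \<le> \<P>(\<omega> in M. - snd S \<omega> < 0)"
      proof (rule finite_measure_mono)
        show "{\<omega> \<in> space M. 0 + m / fst S * snd S \<omega> < 0} \<subseteq> {\<omega> \<in> space M. - snd S \<omega> < 0}"
          using S(3) by (force simp: order.order_iff_strict)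
      qed measurable
      with p have "(\<lambda>\<omega>. 0 + m / fst S * snd S \<omega>) \<in> VaR_acceptance M \<alpha>"
        using bounded_rvs_add_scaled[OF const_in_bounded_rvs[of 0] S(2), of "m / fst S"]
        by (simp add: VaR_acceptance_eq[OF assms(1)])
      then show ?thesis
        unfolding risk_measure_def by (intro Inf_lower) blast
    qed
    then have "risk_measure (VaR_acceptance M \<alpha>) S (\<lambda>_. 0) = -\<infinity>"
      by (rule ereal_bot)
    with gt const_in_bounded_rvs[of 0 M] show False
      by force
  qed
next
  interpret prob_space M by fact
  have S: "0 < fst S" "snd S \<in> bounded_rvs M"
    using assms(2) by (auto simp: traded_asset_def nonneg_bounded_rvs_def)
  have [measurable]: "snd S \<in> borel_measurable M"
    using S(2) by (simp add: bounded_rvs_def)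
  assume "VaR M \<alpha> (\<lambda>\<omega>. - snd S \<omega>) > 0"
  then obtain e where e: "e > 0" and p: "\<P>(\<omega> in M. snd S \<omega> > e) > \<alpha>"
    by (rule VaR_pos_obtains_level)
  show "\<forall>X\<in>bounded_rvs M. risk_measure (VaR_acceptance M \<alpha>) S X > -\<infinity>"
  proof
    fix X assume X: "X \<in> bounded_rvs M"
    have [measurable]: "X \<in> borel_measurable M"
      using X by (simp add: bounded_rvs_def)
    obtain b where b: "b > 0" "\<And>\<omega>. \<omega> \<in> space M \<Longrightarrow> \<bar>X \<omega>\<bar> \<le> b"
      using X by (auto simp: bounded_rvs_def bounded_pos)
    \<comment> \<open>For \<open>m\<close> below this bound, \<open>m / fst S < - (b / e)\<close>.
      Where the payoff exceeds \<open>e\<close>, the supplement is then below \<open>- b\<close> and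
      outweighs any value of \<open>X\<close>; this happens with probability above \<alpha>.\<close>
    have "ereal (- (fst S * b / e)) \<le> risk_measure (VaR_acceptance M \<alpha>) S X"
      unfolding risk_measure_def
    proof (rule Inf_greatest, clarify)
      fix m assume "(\<lambda>\<omega>. X \<omega> + m / fst S * snd S \<omega>) \<in> VaR_acceptance M \<alpha>"
      then have acc: "\<P>(\<omega> in M. X \<omega> + m / fst S * snd S \<omega> < 0) \<le> \<alpha>"
        by (simp add: VaR_acceptance_eq[OF assms(1)])
      have "\<not> m < - (fst S * b / e)"
      proof
        assume "m < - (fst S * b / e)"
        then have m: "m / fst S < - (b / e)"
          using S(1) by (simp add: field_simps)
        have "X \<omega> + m / fst S * snd S \<omega> < 0" if w: "\<omega> \<in> space M" "snd S \<omega> > e" for \<omega>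
        proof -
          have "m / fst S * snd S \<omega> < - (b / e) * snd S \<omega>"
            using m w e by (intro mult_strict_right_mono) auto
          \<comment> \<open>The coefficient is negative, so replacing the payoff by the smaller
            \<open>e\<close> increases the product.\<close>
          also have "\<dots> \<le> - (b / e) * e"
            using w b(1) e by (intro mult_left_mono_neg) auto
          finally show ?thesis
            using b(2)[OF w(1)] e by simp
        qed
        then have "\<P>(\<omega> in M. snd S \<omega> > e) \<le> \<P>(\<omega> in M. X \<omega> + m / fst S * snd S \<omega> < 0)"
          by (intro finite_measure_mono) auto
        with p acc show False by simp
      qed
      then show "ereal (- (fst S * b / e)) \<le> ereal m"
        by simp
    qed
    then show "risk_measure (VaR_acceptance M \<alpha>) S X > -\<infinity>"
      by (rule less_le_trans[rotated]) simp
  qed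
qed

theorem proposition3p6:
  fixes M :: "'a measure" and S :: "real \<times> ('a \<Rightarrow> real)" and \<alpha> :: real
  assumes "prob_space M"
    and "traded_asset M S"
    and "0 < \<alpha>" and "\<alpha> < 1"
  shows
    "(((\<forall>X\<in>bounded_rvs M. risk_measure (VaR_acceptance M \<alpha>) S X < \<infinity>)
         \<longleftrightarrow> VaR M \<alpha> (snd S) < 0)
      \<and> (VaR M \<alpha> (snd S) < 0
         \<longleftrightarrow> (\<exists>l>0. \<P>(\<omega> in M. snd S \<omega> < l) \<le> \<alpha>))
      \<and> (finite (space M) \<longrightarrow>
           ((\<exists>l>0. \<P>(\<omega> in M. snd S \<omega> < l) \<le> \<alpha>)
            \<longleftrightarrow> \<P>(\<omega> in M. snd S \<omega> = 0) \<le> \<alpha>)))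
     \<and>
     (((\<forall>X\<in>bounded_rvs M. risk_measure (VaR_acceptance M \<alpha>) S X > -\<infinity>)
         \<longleftrightarrow> VaR M \<alpha> (\<lambda>\<omega>. - snd S \<omega>) > 0)
      \<and> (VaR M \<alpha> (\<lambda>\<omega>. - snd S \<omega>) > 0
         \<longleftrightarrow> \<P>(\<omega> in M. snd S \<omega> > 0) > \<alpha>)
      \<and> (\<P>(\<omega> in M. snd S \<omega> > 0) > \<alpha>
         \<longleftrightarrow> \<P>(\<omega> in M. snd S \<omega> = 0) < 1 - \<alpha>))"
proof -
  have S: "snd S \<in> nonneg_bounded_rvs M"
    using assms(2) by (simp add: traded_asset_def)
  then have "(\<lambda>\<omega>. - snd S \<omega>) \<in> bounded_rvs M"
    using bounded_rvs_add_scaled[OF const_in_bounded_rvs[of 0], of "snd S" M "- 1"]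
    by (simp add: nonneg_bounded_rvs_def)
  then have "VaR M \<alpha> (\<lambda>\<omega>. - snd S \<omega>) > 0 \<longleftrightarrow> \<P>(\<omega> in M. snd S \<omega> > 0) > \<alpha>"
    using VaR_pos_iff[OF assms(1)] by simp
  then show ?thesis
    using risk_measure_less_top_iff[OF assms(1,2,4)] risk_measure_greater_bot_iff[OF assms(1,2)]
      VaR_neg_iff[of M \<alpha> "snd S"] prob_eq_0_iff_level[OF assms(1) S]
      prob_pos_iff_prob_eq_0[OF assms(1) S]
    by simp
qed

end
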